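(* The following identity of formal power series in $t$ holds: $$\frac{(1-q)H(t)}{H(qt)-qH(t)}=\left\{1-\sum_{r=1}^\infty q^{-1}P^y_{(r)}(q^{-1})\,(qt)^r\right\}^{-1},$$ where $H(t)=\sum_{r\ge0}h_r t^r$ is the generating function of the complete symmetric functions $h_r$ in the variables $y$, and $P^y_{(r)}(q)$ is the Hall–Littlewood symmetric function of the one-row partition $(r)$.
   Context: $\Lambda^y$ is the ring of symmetric functions in variables $y=(y_1,y_2,\dots)$. For a partition $\lambda$, the Hall–Littlewood symmetric function $P^y_\lambda(q)\in\Lambda^y[q]$ is the limit as $k\to\infty$ of the symmetric polynomials $$P_\lambda(y_1,\dots,y_k;q)=\sum_{w\in\mathbb{S}_k/\mathbb{S}_k^\lambda}w\left(y_1^{\lambda_1}\cdots y_k^{\lambda_k}\prod_{\lambda_i>\lambda_j}\frac{y_i-qy_j}{y_i-y_j}\right),\qquad k\ge l(\lambda),$$ where $l(\lambda)$ is the number of positive parts of $\lambda$, $\mathbb{S}_k$ permutes the variables and $\mathbb{S}_k^\lambda$ is the stabilizer of $\lambda$ in $\mathbb{S}_k$. $P^y_{(r)}(q^{-1})$ denotes the substitution $q\mapsto q^{-1}$ in $P^y_{(r)}(q)$. Here $q$ is an indeterminate and coefficients are taken in $\Lambda^y\otimes\mathbb{Q}(q)$. *)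

theory Defs
  imports
    "HOL-Library.Poly_Mapping"
    "HOL-Combinatorics.Permutations"
    "HOL-Computational_Algebra.Formal_Power_Series"
    "HOL-Computational_Algebra.Polynomial_Factorial"
begin

section \<open>Symmetric functions\<close>

text \<open>
  A monomial in the variables \<open>y\<^sub>0, y\<^sub>1, y\<^sub>2, \<dots>\<close> is its finitely supported exponent vector
  \<open>nat \<Rightarrow>\<^sub>0 nat\<close>; variables are numbered from 0.
\<close>

type_synonym monomial = "nat \<Rightarrow>\<^sub>0 nat"

definition mdeg :: "monomial \<Rightarrow> nat" where
  "mdeg m = (\<Sum>i\<in>Poly_Mapping.keys m. Poly_Mapping.lookup m i)"

lemma mdeg_superset:
  assumes "finite A" "Poly_Mapping.keys m \<subseteq> A"
  shows "mdeg m = (\<Sum>i\<in>A. Poly_Mapping.lookup m i)"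
  unfolding mdeg_def by (rule sum.mono_neutral_left) (use assms in \<open>auto simp: in_keys_iff\<close>)

lemma mdeg_0 [simp]: "mdeg 0 = 0"
  by (simp add: mdeg_def)

lemma mdeg_add: "mdeg (a + b) = mdeg a + mdeg b"
proof -
  let ?A = "Poly_Mapping.keys a \<union> Poly_Mapping.keys b"
  have "mdeg (a + b) = (\<Sum>i\<in>?A. Poly_Mapping.lookup (a + b) i)"
    by (rule mdeg_superset) (auto simp: in_keys_iff lookup_add)
  also have "\<dots> = (\<Sum>i\<in>?A. Poly_Mapping.lookup a i) + (\<Sum>i\<in>?A. Poly_Mapping.lookup b i)"
    by (simp add: lookup_add sum.distrib)
  also have "\<dots> = mdeg a + mdeg b"
    using mdeg_superset[of ?A a] mdeg_superset[of ?A b] by auto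
  finally show ?thesis .
qed

lemma mdeg_eq_0_iff [simp]: "mdeg m = 0 \<longleftrightarrow> m = 0"
proof
  assume "mdeg m = 0"
  then have "\<forall>i\<in>Poly_Mapping.keys m. Poly_Mapping.lookup m i = 0"
    by (simp add: mdeg_def)
  then show "m = 0" by (metis in_keys_iff lookup_zero poly_mapping_eqI)
qed simp

lemma mdeg_map_key:
  assumes "bij f"
  shows "mdeg (Poly_Mapping.map_key f m) = mdeg m"
proof -
  have inj: "inj f" using assms by (rule bij_is_inj)
  have "(\<Sum>i\<in>f -` Poly_Mapping.keys m. Poly_Mapping.lookup m (f i)) =
        (\<Sum>i\<in>Poly_Mapping.keys m. Poly_Mapping.lookup m i)"
    by (rule sum.reindex_bij_betw)
       (use assms in \<open>auto simp: bij_betw_def inj_on_def image_vimage_eq\<close>)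
  then show ?thesis
    by (simp add: mdeg_def keys_map_key[OF inj] map_key.rep_eq[OF inj])
qed

lemma map_key_eq_0_iff: "bij (f :: nat \<Rightarrow> nat) \<Longrightarrow> Poly_Mapping.map_key f m = 0 \<longleftrightarrow> m = (0 :: monomial)"
  using mdeg_map_key[of f m] mdeg_eq_0_iff[of "Poly_Mapping.map_key f m"] mdeg_eq_0_iff[of m]
  by metis

definition msplit :: "monomial \<Rightarrow> (monomial \<times> monomial) set" where
  "msplit m = {(a, b). a + b = m}"

lemma finite_msplit [simp]: "finite (msplit m)"
proof -
  let ?F = "{f :: nat \<Rightarrow> nat. \<forall>x. (x \<in> Poly_Mapping.keys m \<longrightarrow> f x \<in> {..mdeg m}) \<and>
              (x \<notin> Poly_Mapping.keys m \<longrightarrow> f x = 0)}"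
  have F: "finite ?F" by (rule finite_set_of_finite_funs) auto
  have le: "Poly_Mapping.lookup m i \<le> mdeg m" for i
    by (cases "i \<in> Poly_Mapping.keys m") (auto simp: mdeg_def in_keys_iff intro: member_le_sum)
  let ?g = "\<lambda>p. (Poly_Mapping.lookup (fst p), Poly_Mapping.lookup (snd p))"
  have "?g p \<in> ?F \<times> ?F" if p: "p \<in> msplit m" for p
  proof -
    have "Poly_Mapping.lookup m i = Poly_Mapping.lookup (fst p) i + Poly_Mapping.lookup (snd p) i" for i
      using p by (auto simp: msplit_def lookup_add)
    moreover from this have "Poly_Mapping.lookup (fst p) i \<le> mdeg m"
      "Poly_Mapping.lookup (snd p) i \<le> mdeg m" for i
      using le[of i] by auto
    ultimately show ?thesis by (simp add: in_keys_iff)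
  qed
  then have "?g ` msplit m \<subseteq> ?F \<times> ?F" by blast
  moreover have "inj_on ?g (msplit m)"
    by (rule inj_onI) (simp add: lookup_inject prod_eq_iff)
  ultimately show ?thesis
    using finite_cartesian_product[OF F F] by (meson inj_on_finite)
qed

lemma msplit_0 [simp]: "msplit 0 = {(0, 0)}"
proof -
  have "a + b = 0 \<longleftrightarrow> a = 0 \<and> b = 0" for a b :: monomial
    using mdeg_add[of a b] by auto
  then show ?thesis by (auto simp: msplit_def)
qed

text \<open>
  Symmetric functions over a commutative ring are the formal power series in infinitely many
  variables that have bounded degree and are invariant under permutations of the variables.
  The series is represented by its coefficient function. Bounded degree makes the functions over
  \<open>R[q]\<close> the same as \<open>\<Lambda>[q]\<close>, and those over \<open>\<rat>(q)\<close> the same as \<open>\<Lambda> \<otimes> \<rat>(q)\<close>.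
\<close>

typedef (overloaded) 'a symfun =
  "{f :: monomial \<Rightarrow> 'a :: comm_ring_1.
      (\<forall>\<sigma> m. bij \<sigma> \<longrightarrow> f (Poly_Mapping.map_key \<sigma> m) = f m) \<and> (\<exists>d. \<forall>m. mdeg m > d \<longrightarrow> f m = 0)}"
  morphisms sf_coeff Abs_symfun
  by (rule exI[of _ "\<lambda>_. 0"]) auto

setup_lifting type_definition_symfun

lemma symfun_eqI: "(\<And>m. sf_coeff f m = sf_coeff g m) \<Longrightarrow> f = g"
  by transfer auto

lemma bij_betw_msplit:
  assumes "bij \<sigma>"
  shows "bij_betw (\<lambda>(a, b). (Poly_Mapping.map_key \<sigma> a, Poly_Mapping.map_key \<sigma> b))
           (msplit m) (msplit (Poly_Mapping.map_key \<sigma> m))"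
proof -
  have inj: "inj \<sigma>" using assms by (rule bij_is_inj)
  have inj': "inj (inv \<sigma>)" using assms by (simp add: bij_imp_bij_inv bij_is_inj)
  have *: "Poly_Mapping.map_key (inv \<sigma>) (Poly_Mapping.map_key \<sigma> a) = a" for a
    using assms by (simp add: map_key_compose inj inj' o_def bij_is_surj surj_f_inv_f map_key_id)
  have **: "Poly_Mapping.map_key \<sigma> (Poly_Mapping.map_key (inv \<sigma>) a) = a" for a
    using assms by (simp add: map_key_compose inj inj' o_def inv_f_f map_key_id)
  have plus: "Poly_Mapping.map_key \<sigma> (a + b) = Poly_Mapping.map_key \<sigma> a + Poly_Mapping.map_key \<sigma> b"
    "Poly_Mapping.map_key (inv \<sigma>) (a + b) =
      Poly_Mapping.map_key (inv \<sigma>) a + Poly_Mapping.map_key (inv \<sigma>) b" for a b :: monomial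
    by (rule map_key_plus[OF inj], rule map_key_plus[OF inj'])
  let ?g = "\<lambda>(a, b). (Poly_Mapping.map_key (inv \<sigma>) a, Poly_Mapping.map_key (inv \<sigma>) b)"
  show ?thesis
  proof (rule bij_betw_byWitness[where f' = ?g])
    show "?g ` msplit (Poly_Mapping.map_key \<sigma> m) \<subseteq> msplit m"
    proof (clarsimp simp: msplit_def)
      fix a b assume "a + b = Poly_Mapping.map_key \<sigma> m"
      then have "Poly_Mapping.map_key (inv \<sigma>) (a + b) = m" by (simp add: *)
      then show "Poly_Mapping.map_key (inv \<sigma>) a + Poly_Mapping.map_key (inv \<sigma>) b = m"
        by (simp add: plus)
    qed
  qed (auto simp: msplit_def * ** plus)
qed

instantiation symfun :: (comm_ring_1) comm_ring_1
begin

lift_definition zero_symfun :: "'a symfun" is "\<lambda>_. 0"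
  by simp

lift_definition one_symfun :: "'a symfun" is "\<lambda>m. if m = 0 then 1 else 0"
proof (intro conjI, goal_cases)
  case 1
  then show ?case by (simp add: map_key_eq_0_iff)
next
  case 2
  then show ?case by (intro exI[of _ 0]) auto
qed

lift_definition plus_symfun :: "'a symfun \<Rightarrow> 'a symfun \<Rightarrow> 'a symfun" is "\<lambda>f g m. f m + g m"
proof (intro conjI, goal_cases)
  case (2 f g)
  then obtain d e where "\<forall>m. mdeg m > d \<longrightarrow> f m = 0" "\<forall>m. mdeg m > e \<longrightarrow> g m = 0" by auto
  then show ?case by (intro exI[of _ "max d e"]) auto
qed auto

lift_definition uminus_symfun :: "'a symfun \<Rightarrow> 'a symfun" is "\<lambda>f m. - f m"
  by auto

definition minus_symfun :: "'a symfun \<Rightarrow> 'a symfun \<Rightarrow> 'a symfun" where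
  "minus_symfun f g = f + (- g)"

lift_definition times_symfun :: "'a symfun \<Rightarrow> 'a symfun \<Rightarrow> 'a symfun"
  is "\<lambda>f g m. \<Sum>(a, b)\<in>msplit m. f a * g b"
proof (intro conjI, goal_cases)
  case (1 f g)
  have "(\<Sum>(a, b)\<in>msplit (Poly_Mapping.map_key \<sigma> m). f a * g b) = (\<Sum>(a, b)\<in>msplit m. f a * g b)"
    if "bij \<sigma>" for \<sigma> m
    by (subst sum.reindex_bij_betw[OF bij_betw_msplit[OF that], symmetric], rule sum.cong)
       (use 1 that in auto)
  then show ?case by blast
next
  case (2 f g)
  then obtain d e where d: "\<And>m. mdeg m > d \<Longrightarrow> f m = 0" and e: "\<And>m. mdeg m > e \<Longrightarrow> g m = 0"
    by auto
  have "f a * g b = 0" if "(a, b) \<in> msplit m" "mdeg m > d + e" for a b m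
  proof -
    have "mdeg a > d \<or> mdeg b > e" using that mdeg_add[of a b] by (auto simp: msplit_def)
    then show ?thesis using d e by auto
  qed
  then show ?case by (intro exI[of _ "d + e"]) (auto intro!: sum.neutral)
qed

instance
proof
  fix f g h :: "'a symfun"
  show "f + g + h = f + (g + h)" by transfer (simp add: add.assoc)
  show "f + g = g + f" by transfer (simp add: add.commute)
  show "0 + f = f" by transfer simp
  show "- f + f = 0" by transfer simp
  show "f - g = f + - g" by (simp add: minus_symfun_def)
  show "(f + g) * h = f * h + g * h"
    by transfer (simp add: distrib_right sum.distrib case_prod_beta)
  show "(0 :: 'a symfun) \<noteq> 1" by transfer (metis zero_neq_one)
  show "f * g = g * f"
  proof (transfer, rule ext)
    fix f g :: "monomial \<Rightarrow> 'a" and m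
    show "(\<Sum>(a, b)\<in>msplit m. f a * g b) = (\<Sum>(a, b)\<in>msplit m. g a * f b)"
      by (rule sum.reindex_bij_witness[where i = prod.swap and j = prod.swap])
         (auto simp: msplit_def add.commute mult.commute)
  qed
  show "1 * f = f"
  proof (transfer, rule ext)
    fix f :: "monomial \<Rightarrow> 'a" and m
    have "(\<Sum>(a, b)\<in>msplit m. (if a = 0 then 1 else 0) * f b) =
          (\<Sum>(a, b)\<in>{(0 :: monomial, m)}. (if a = 0 then 1 else 0) * f b)"
      by (rule sum.mono_neutral_right[OF finite_msplit]) (auto simp: msplit_def split: if_splits)
    then show "(\<Sum>(a, b)\<in>msplit m. (if a = 0 then 1 else 0) * f b) = f m" by simp
  qed
  show "f * g * h = f * (g * h)"
  proof (transfer, rule ext)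
    fix f g h :: "monomial \<Rightarrow> 'a" and m
    have "(\<Sum>(p, c)\<in>msplit m. (\<Sum>(a, b)\<in>msplit p. f a * g b) * h c) =
          (\<Sum>x\<in>msplit m. \<Sum>y\<in>msplit (fst x). f (fst y) * g (snd y) * h (snd x))"
      by (simp add: sum_distrib_right case_prod_beta)
    also have "\<dots> = (\<Sum>(x, y)\<in>Sigma (msplit m) (\<lambda>x. msplit (fst x)). f (fst y) * g (snd y) * h (snd x))"
      by (rule sum.Sigma) simp_all
    also have "\<dots> = (\<Sum>(x, y)\<in>Sigma (msplit m) (\<lambda>x. msplit (snd x)). f (fst x) * (g (fst y) * h (snd y)))"
      by (rule sum.reindex_bij_witness[where
            i = "\<lambda>((a, p), (b, c)). ((a + b, c), (a, b))" and
            j = "\<lambda>((p, c), (a, b)). ((a, b + c), (b, c))"])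
         (auto simp: msplit_def add.assoc mult.assoc)
    also have "\<dots> = (\<Sum>x\<in>msplit m. \<Sum>y\<in>msplit (snd x). f (fst x) * (g (fst y) * h (snd y)))"
      by (rule sum.Sigma[symmetric]) simp_all
    also have "\<dots> = (\<Sum>(a, p)\<in>msplit m. f a * (\<Sum>(b, c)\<in>msplit p. g b * h c))"
      by (simp add: sum_distrib_left case_prod_beta)
    finally show "(\<Sum>(p, c)\<in>msplit m. (\<Sum>(a, b)\<in>msplit p. f a * g b) * h c) =
      (\<Sum>(a, p)\<in>msplit m. f a * (\<Sum>(b, c)\<in>msplit p. g b * h c))" .
  qed
qed

end

lift_definition sf_const :: "'a \<Rightarrow> 'a :: comm_ring_1 symfun" is "\<lambda>c m. if m = 0 then c else 0"
proof (intro conjI, goal_cases)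
  case (1 c)
  then show ?case by (simp add: map_key_eq_0_iff)
next
  case (2 c)
  then show ?case by (intro exI[of _ 0]) auto
qed

lemma sf_const_1 [simp]: "sf_const 1 = 1"
  by transfer auto

lemma sf_const_add: "sf_const (a + b) = sf_const a + sf_const b"
  by transfer auto

lemma sf_const_uminus: "sf_const (- a) = - sf_const a"
  by transfer auto

lemma sf_const_diff: "sf_const (a - b) = sf_const a - sf_const b"
  using sf_const_add[of a "- b"] by (simp add: sf_const_uminus)

lemma sf_const_mult: "sf_const (a * b) = sf_const a * sf_const b"
proof (transfer, rule ext)
  fix a b :: 'a and m :: monomial
  show "(if m = 0 then a * b else 0) =
    (\<Sum>(u, v)\<in>msplit m. (if u = 0 then a else 0) * (if v = 0 then b else 0))"
  proof (cases "m = 0")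
    case True
    then show ?thesis by simp
  next
    case False
    then have "(if fst p = 0 then a else 0) * (if snd p = 0 then b else 0) = 0" if "p \<in> msplit m" for p
      using that by (auto simp: msplit_def)
    then show ?thesis using False by (simp add: case_prod_beta)
  qed
qed

text \<open>
  The inverse of a unit, and 0 for a non-unit. This makes the library's \<^term>\<open>inverse\<close> and
  division on formal power series available over the ring of symmetric functions; by
  \<open>fps_symfun_inverse\<close> and \<open>fps_symfun_divide\<close> below they are the inverse and the quotient in the
  power series ring whenever the constant coefficient of the denominator is a unit.
\<close>

instantiation symfun :: (comm_ring_1) inverse
begin

definition inverse_symfun :: "'a symfun \<Rightarrow> 'a symfun" where
  "inverse_symfun f = (if f dvd 1 then (THE g. f * g = 1) else 0)"

definition divide_symfun :: "'a symfun \<Rightarrow> 'a symfun \<Rightarrow> 'a symfun" where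
  "divide_symfun f g = f * inverse g"

instance ..

end

lemma symfun_inverse:
  fixes f :: "'a :: comm_ring_1 symfun"
  assumes "f dvd 1"
  shows "f * inverse f = 1"
proof -
  obtain g where g: "f * g = 1" using assms by (metis dvdE)
  have "h = g" if "f * h = 1" for h
  proof -
    have "h = (f * g) * h" by (simp add: g)
    also have "\<dots> = g * (f * h)" by (simp add: ac_simps)
    finally show ?thesis by (simp add: that)
  qed
  then have "\<exists>!g. f * g = 1" using g by blast
  then have "f * (THE g. f * g = 1) = 1" by (rule theI')
  then show ?thesis using assms by (simp add: inverse_symfun_def)
qed

lemma fps_symfun_inverse:
  fixes F :: "'a :: comm_ring_1 symfun fps"
  assumes "fps_nth F 0 dvd 1"
  shows "F * inverse F = 1"
  unfolding fps_inverse_def by (rule fps_right_inverse) (rule symfun_inverse[OF assms])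

lemma fps_symfun_divide:
  fixes F G :: "'a :: comm_ring_1 symfun fps"
  assumes "fps_nth G 0 dvd 1"
  shows "F / G = F * inverse G" "G * (F / G) = F"
proof -
  have "fps_nth G 0 \<noteq> 0" using assms by auto
  then show *: "F / G = F * inverse G" by (rule fps_divide_unit)
  have "G * (F * inverse G) = F * (G * inverse G)" by (simp add: ac_simps)
  then show "G * (F / G) = F" by (simp add: * fps_symfun_inverse[OF assms])
qed

section \<open>Complete symmetric functions\<close>

text \<open>\<open>h\<^sub>r\<close> is the sum of all monomials of degree \<open>r\<close>.\<close>

lift_definition sf_h :: "nat \<Rightarrow> 'a :: comm_ring_1 symfun" is "\<lambda>r m. if mdeg m = r then 1 else 0"
proof (intro conjI, goal_cases)
  case (1 r)
  then show ?case by (simp add: mdeg_map_key)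
next
  case (2 r)
  then show ?case by (intro exI[of _ r]) auto
qed

definition sf_H :: "'a :: comm_ring_1 symfun fps" where
  "sf_H = Abs_fps sf_h"

lemma sf_h_0 [simp]: "sf_h 0 = 1"
  by transfer auto

section \<open>Hall--Littlewood symmetric functions\<close>

text \<open>
  Polynomials over \<open>\<rat>[q]\<close> in the variables \<open>y\<^sub>i\<close> are finitely supported functions on monomials, and
  rational functions are their fractions.
\<close>

type_synonym ypoly = "monomial \<Rightarrow>\<^sub>0 rat poly"

definition Y :: "nat \<Rightarrow> ypoly fract" where
  "Y i = to_fract (Poly_Mapping.single (Poly_Mapping.single i 1) 1)"

definition Yq :: "ypoly fract" where
  "Yq = to_fract (Poly_Mapping.single 0 [:0, 1:])"

text \<open>
  A partition is given by the list of its positive parts in weakly decreasing order, and its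
  \<open>i\<close>-th part (\<open>i \<ge> 0\<close>) is \<open>part lam i\<close>, which is 0 beyond the length. \<open>hl_term lam k w\<close> is \<open>w\<close>,
  acting by \<open>y\<^sub>i \<mapsto> y\<^bsub>w i\<^esub>\<close>, applied to the product in the definition.
\<close>

definition part :: "nat list \<Rightarrow> nat \<Rightarrow> nat" where
  "part lam = nth_default 0 lam"

definition hl_term :: "nat list \<Rightarrow> nat \<Rightarrow> (nat \<Rightarrow> nat) \<Rightarrow> ypoly fract" where
  "hl_term lam k w =
     (\<Prod>i<k. Y (w i) ^ part lam i) *
     (\<Prod>(i, j)\<in>{(i, j). i < k \<and> j < k \<and> part lam i > part lam j}.
        (Y (w i) - Yq * Y (w j)) / (Y (w i) - Y (w j)))"

definition hl_stab :: "nat list \<Rightarrow> nat \<Rightarrow> (nat \<Rightarrow> nat) set" where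
  "hl_stab lam k = {s. s permutes {..<k} \<and> (\<forall>i<k. part lam (s i) = part lam i)}"

definition hl_cosets :: "nat list \<Rightarrow> nat \<Rightarrow> (nat \<Rightarrow> nat) set set" where
  "hl_cosets lam k = (\<lambda>w. (\<lambda>s. w \<circ> s) ` hl_stab lam k) ` {w. w permutes {..<k}}"

text \<open>The choice of a representative of each coset below is immaterial.\<close>

lemma hl_term_coset:
  assumes "s \<in> hl_stab lam k"
  shows "hl_term lam k (w \<circ> s) = hl_term lam k w"
proof -
  have s: "s permutes {..<k}" and ps: "\<And>i. i < k \<Longrightarrow> part lam (s i) = part lam i"
    using assms by (auto simp: hl_stab_def)
  have bij: "bij_betw s {..<k} {..<k}" using s by (rule permutes_imp_bij)
  have sk: "s i < k \<longleftrightarrow> i < k" for i using permutes_in_image[OF s, of i] by auto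
  have si: "inv s i < k \<longleftrightarrow> i < k" for i
    using permutes_in_image[OF permutes_inv[OF s], of i] by auto
  have pi: "part lam (inv s i) = part lam i" if "i < k" for i
    using ps[of "inv s i"] that si by (simp add: permutes_inverses[OF s])
  have "(\<Prod>i<k. Y ((w \<circ> s) i) ^ part lam i) = (\<Prod>i<k. Y (w (s i)) ^ part lam (s i))"
    by (rule prod.cong) (auto simp: ps)
  also have "\<dots> = (\<Prod>i<k. Y (w i) ^ part lam i)"
    by (rule prod.reindex_bij_betw[OF bij])
  finally have 1: "(\<Prod>i<k. Y ((w \<circ> s) i) ^ part lam i) = (\<Prod>i<k. Y (w i) ^ part lam i)" .
  have 2: "(\<Prod>(i, j)\<in>{(i, j). i < k \<and> j < k \<and> part lam i > part lam j}.
        (Y ((w \<circ> s) i) - Yq * Y ((w \<circ> s) j)) / (Y ((w \<circ> s) i) - Y ((w \<circ> s) j))) =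
      (\<Prod>(i, j)\<in>{(i, j). i < k \<and> j < k \<and> part lam i > part lam j}.
        (Y (w i) - Yq * Y (w j)) / (Y (w i) - Y (w j)))"
    by (rule prod.reindex_bij_witness[where i = "\<lambda>(i, j). (inv s i, inv s j)"
          and j = "\<lambda>(i, j). (s i, s j)"])
       (auto simp: permutes_inverses[OF s] sk si ps pi)
  show ?thesis unfolding hl_term_def 1 2 ..
qed

definition hl_fract :: "nat list \<Rightarrow> nat \<Rightarrow> ypoly fract" where
  "hl_fract lam k = (\<Sum>C\<in>hl_cosets lam k. hl_term lam k (SOME w. w \<in> C))"

text \<open>
  For a partition of length at most \<open>k\<close>, \<open>hl_fract lam k\<close> is a polynomial. The limit over \<open>k\<close> is
  taken coefficientwise: each coefficient is eventually constant.
\<close>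

definition hl_poly :: "nat list \<Rightarrow> nat \<Rightarrow> ypoly" where
  "hl_poly lam k = (THE p. to_fract p = hl_fract lam k)"

definition hall_littlewood :: "nat list \<Rightarrow> rat poly symfun" where
  "hall_littlewood lam =
     (THE f. \<forall>m. \<forall>\<^sub>F k in sequentially. Poly_Mapping.lookup (hl_poly lam k) m = sf_coeff f m)"

text \<open>The map \<open>\<Lambda>[q] \<rightarrow> \<Lambda> \<otimes> \<rat>(q)\<close> that substitutes an element of \<open>\<rat>(q)\<close> for \<open>q\<close>.\<close>

type_synonym rat_fun = "rat poly fract"

definition qvar :: rat_fun where
  "qvar = to_fract [:0, 1:]"

lift_definition sf_subst :: "rat_fun \<Rightarrow> rat poly symfun \<Rightarrow> rat_fun symfun"
  is "\<lambda>x f m. poly (map_poly (\<lambda>c. to_fract [:c:]) (f m)) x"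
  by fastforce

section \<open>Invertibility of the denominators\<close>

abbreviation sf_q :: "rat_fun symfun" where
  "sf_q \<equiv> sf_const qvar"

text \<open>The power series \<open>qt\<close>.\<close>

abbreviation qt :: "rat_fun symfun fps" where
  "qt \<equiv> fps_const sf_q * fps_X"

lemma qvar_neq: "qvar \<noteq> 0" "qvar \<noteq> 1"
proof -
  show "qvar \<noteq> 0" by (simp add: qvar_def)
  have "to_fract [:0, 1 :: rat:] \<noteq> to_fract 1" by (simp add: one_pCons)
  then show "qvar \<noteq> 1" by (simp add: qvar_def)
qed

lemma sf_const_unit:
  fixes c :: "'a :: field"
  assumes "c \<noteq> 0"
  shows "sf_const c dvd 1"
  by (rule dvdI[of _ _ "sf_const (inverse c)"]) (use assms in \<open>simp flip: sf_const_mult\<close>)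

lemma denominator_lhs_unit: "fps_nth ((sf_H oo qt) - fps_const sf_q * sf_H) 0 dvd 1"
proof -
  have "fps_nth ((sf_H oo qt) - fps_const sf_q * sf_H) 0 = sf_const (1 - qvar)"
    by (simp add: sf_H_def sf_const_diff)
  then show ?thesis using sf_const_unit[of "1 - qvar"] qvar_neq by simp
qed

lemma denominator_rhs_unit:
  "fps_nth (1 - (Abs_fps (\<lambda>r. if r = 0 then 0 else c r) oo qt)) 0 dvd 1"
  by simp

end

theory Submission
  imports Defs
begin

text \<open>
  For distinct nonzero \<open>x\<^sub>i\<close>, partial fractions give
  \<open>1 + (1 - q) \<Sum>\<^sub>r P\<^sub>(\<^sub>r\<^sub>)(x; q) t\<^sup>r = \<Prod>\<^sub>i (1 - q x\<^sub>i t) / (1 - x\<^sub>i t)\<close> (sum over \<open>r \<ge> 1\<close>).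
  Expanding each factor as \<open>1 + (1 - q) \<Sum>\<^sub>s (x\<^sub>i t)\<^sup>s\<close> with \<open>s \<ge> 1\<close>, the coefficient of \<open>P\<^sub>(\<^sub>r\<^sub>)\<close> at a
  monomial of degree \<open>r\<close> in exactly \<open>l\<close> variables is \<open>(1 - q)\<^bsup>l - 1\<^esup>\<close>. Replacing \<open>q\<close> by its inverse
  and \<open>t\<close> by \<open>q t\<close> turns the product into \<open>H(q t) / H(t)\<close>, which is the claim; on coefficients
  this is a telescoping sum in each variable separately.
\<close>

section \<open>Partial fractions and the product formula for one-row sums\<close>

text \<open>Since \<open>degree f < card B\<close>, Lagrange interpolation on \<open>B\<close>
  recovers \<open>f\<close>. The basis polynomials \<open>b x\<close> are monic of degree
  \<open>card B - 1\<close>, so the sum is the coefficient of the interpolant in that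
  degree.\<close>

lemma sum_divided_differences:
  fixes f :: "'a :: field poly"
  assumes B: "finite B" and deg: "degree f < card B"
  shows "(\<Sum>x\<in>B. poly f x / (\<Prod>y\<in>B - {x}. x - y)) = coeff f (card B - 1)"
proof -
  define b where "b x = (\<Prod>y\<in>B - {x}. [:- y, 1:])" for x
  define L where "L = (\<Sum>x\<in>B. smult (poly f x / (\<Prod>y\<in>B - {x}. x - y)) (b x))"
  have deg_b: "degree (b x) = card B - 1" and lead_b: "coeff (b x) (card B - 1) = 1"
    if "x \<in> B" for x
  proof -
    show deg_bx: "degree (b x) = card B - 1"
      unfolding b_def using that B by (subst degree_prod_sum_eq) auto
    have "lead_coeff (b x) = 1" unfolding b_def by (subst lead_coeff_prod) simp
    then show "coeff (b x) (card B - 1) = 1" by (simp add: deg_bx)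
  qed
  have "poly f z = poly L z" if z: "z \<in> B" for z
  proof -
    have nz: "(\<Prod>y\<in>B - {z}. z - y) \<noteq> 0" using B by auto
    have "poly L z = (\<Sum>x\<in>B. poly f x / (\<Prod>y\<in>B - {x}. x - y) * (\<Prod>y\<in>B - {x}. z - y))"
      by (simp add: L_def b_def poly_sum poly_prod)
    also have "\<dots> = (\<Sum>x\<in>{z}. poly f x / (\<Prod>y\<in>B - {x}. x - y) * (\<Prod>y\<in>B - {x}. z - y))"
      using z B by (intro sum.mono_neutral_right) auto
    finally show ?thesis using nz by simp
  qed
  moreover have "degree L < card B"
  proof -
    have "degree L \<le> card B - 1"
      unfolding L_def using deg_b by (intro degree_sum_le B) (metis degree_smult_le)
    then show ?thesis using deg by linarith
  qed
  ultimately have "f = L" using deg by (intro poly_eqI_degree) auto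
  then have "coeff f (card B - 1) = coeff L (card B - 1)" by simp
  also have "\<dots> = (\<Sum>x\<in>B. poly f x / (\<Prod>y\<in>B - {x}. x - y))"
    using lead_b by (simp add: L_def coeff_sum)
  finally show ?thesis ..
qed

lemma sum_hl_products:
  fixes q :: "'a :: field"
  assumes A: "finite A" "0 \<notin> A"
  shows "(1 - q) * (\<Sum>x\<in>A. \<Prod>y\<in>A - {x}. (x - q * y) / (x - y)) = 1 - q ^ card A"
proof -
  \<comment> \<open>Divided difference of \<open>\<Prod>y\<in>A. X - q y\<close> at the points of \<open>A\<close> together with 0.\<close>
  define f where "f = (\<Prod>y\<in>A. [:- (q * y), 1:])"
  have deg: "degree f = card A" unfolding f_def by (subst degree_prod_sum_eq) auto
  have lead: "coeff f (card A) = 1"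
    unfolding deg[symmetric] by (simp add: f_def lead_coeff_prod)
  have pf: "poly f z = (\<Prod>y\<in>A. z - q * y)" for z by (simp add: f_def poly_prod)
  have nz: "(\<Prod>y\<in>A. - y) \<noteq> 0" using A by auto
  have at0: "poly f 0 / (\<Prod>y\<in>A. - y) = q ^ card A"
  proof -
    have "poly f 0 = (\<Prod>y\<in>A. q * - y)" by (simp add: pf)
    also have "\<dots> = q ^ card A * (\<Prod>y\<in>A. - y)" by (simp only: prod.distrib prod_constant)
    finally show ?thesis using nz by simp
  qed
  \<comment> \<open>The factor \<open>y = x\<close> of \<open>poly f x\<close> is
    \<open>x * (1 - q)\<close>; its \<open>x\<close> cancels the difference \<open>x - 0\<close>
    coming from the added point 0.\<close>
  have atx: "poly f x / (\<Prod>y\<in>insert 0 A - {x}. x - y) =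
      (1 - q) * (\<Prod>y\<in>A - {x}. (x - q * y) / (x - y))" if x: "x \<in> A" for x
  proof -
    have "x \<noteq> 0" using x A by auto
    have "insert 0 A - {x} = insert 0 (A - {x})" using x A by auto
    then have "(\<Prod>y\<in>insert 0 A - {x}. x - y) = x * (\<Prod>y\<in>A - {x}. x - y)" using A by simp
    moreover have "poly f x = x * (1 - q) * (\<Prod>y\<in>A - {x}. x - q * y)"
      unfolding pf using A x by (subst prod.remove[of _ x]) (auto simp: algebra_simps)
    ultimately show ?thesis using \<open>x \<noteq> 0\<close> by (simp add: prod_dividef)
  qed
  have "1 = (\<Sum>x\<in>insert 0 A. poly f x / (\<Prod>y\<in>insert 0 A - {x}. x - y))"
    using sum_divided_differences[of "insert 0 A" f] A deg lead by simp
  also have "\<dots> = q ^ card A + (\<Sum>x\<in>A. (1 - q) * (\<Prod>y\<in>A - {x}. (x - q * y) / (x - y)))"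
    using A at0 atx by simp
  finally show ?thesis by (simp add: sum_distrib_left algebra_simps)
qed

text \<open>For \<open>r > 0\<close> this is the one-row Hall-Littlewood polynomial at the points of
  \<open>A\<close>, as a sum over cosets. At \<open>r = 0\<close> it differs in general from the
  polynomial of the empty partition, which is 1.\<close>

definition hl_row_sum :: "'a \<Rightarrow> 'a set \<Rightarrow> nat \<Rightarrow> 'a :: field" where
  "hl_row_sum q A r = (\<Sum>x\<in>A. x ^ r * (\<Prod>y\<in>A - {x}. (x - q * y) / (x - y)))"

text \<open>The factor \<open>x - z\<close> in \<open>x ^ r * (x - z)\<close> kills the term
  \<open>x = z\<close>, and for \<open>x\<close> in \<open>A\<close> it cancels the denominator
  \<open>x - z\<close>, leaving \<open>x - q * z\<close>.\<close>

lemma hl_row_sum_insert: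
  assumes A: "finite A" "z \<notin> A"
  shows "hl_row_sum q (insert z A) (Suc r) - z * hl_row_sum q (insert z A) r =
    hl_row_sum q A (Suc r) - q * z * hl_row_sum q A r"
proof -
  let ?B = "insert z A"
  have "hl_row_sum q ?B (Suc r) - z * hl_row_sum q ?B r =
      (\<Sum>x\<in>?B. x ^ r * (x - z) * (\<Prod>y\<in>?B - {x}. (x - q * y) / (x - y)))"
    by (simp add: hl_row_sum_def sum_distrib_left flip: sum_subtractf)
       (simp add: algebra_simps)
  also have "\<dots> = (\<Sum>x\<in>A. x ^ r * (x - z) * (\<Prod>y\<in>?B - {x}. (x - q * y) / (x - y)))"
    using A by simp
  also have "\<dots> = (\<Sum>x\<in>A. x ^ r * (x - q * z) * (\<Prod>y\<in>A - {x}. (x - q * y) / (x - y)))"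
  proof (rule sum.cong)
    fix x assume x: "x \<in> A"
    then have "?B - {x} = insert z (A - {x})" "x \<noteq> z" using A by auto
    then show "x ^ r * (x - z) * (\<Prod>y\<in>?B - {x}. (x - q * y) / (x - y)) =
        x ^ r * (x - q * z) * (\<Prod>y\<in>A - {x}. (x - q * y) / (x - y))"
      using A by simp
  qed simp
  also have "\<dots> = hl_row_sum q A (Suc r) - q * z * hl_row_sum q A r"
    by (simp add: hl_row_sum_def sum_distrib_left flip: sum_subtractf)
       (simp add: algebra_simps)
  finally show ?thesis .
qed

lemma one_minus_const_X_mult_nth:
  "fps_nth ((1 - fps_const c * fps_X) * F) (Suc n) = fps_nth F (Suc n) - c * fps_nth F n"
  for F :: "'a :: comm_ring_1 fps"
  by (simp add: left_diff_distrib mult.assoc)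

text \<open>By the recurrence, adjoining \<open>z\<close> multiplies the series by (1 - q z t) / (1
  - z t). As the constant coefficient is set to 1, degree 1 needs a correction, which
  \<open>sum_hl_products\<close> supplies.\<close>

lemma hl_row_sum_fps:
  fixes q :: "'a :: field"
  assumes "finite A" "0 \<notin> A"
  shows "Abs_fps (\<lambda>r. if r = 0 then 1 else (1 - q) * hl_row_sum q A r) *
      (\<Prod>x\<in>A. 1 - fps_const x * fps_X) = (\<Prod>x\<in>A. 1 - fps_const (q * x) * fps_X)"
  using assms
proof (induction A rule: finite_induct)
  case empty
  show ?case by (simp add: fps_eq_iff hl_row_sum_def)
next
  case (insert z A)
  define F where "F A = Abs_fps (\<lambda>r. if r = 0 then 1 else (1 - q) * hl_row_sum q A r)" for A
  have T: "(1 - q) * hl_row_sum q A 0 = 1 - q ^ card A" if "finite A" "0 \<notin> A" for A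
    using sum_hl_products[OF that] by (simp add: hl_row_sum_def)
  have step: "(1 - fps_const z * fps_X) * F (insert z A) = (1 - fps_const (q * z) * fps_X) * F A"
  proof (rule fps_ext)
    fix n
    have rec: "(1 - q) * hl_row_sum q (insert z A) (Suc r) - z * ((1 - q) * hl_row_sum q (insert z A) r) =
        (1 - q) * hl_row_sum q A (Suc r) - q * z * ((1 - q) * hl_row_sum q A r)" for r
      using arg_cong[OF hl_row_sum_insert[of A z q r], of "\<lambda>u. (1 - q) * u"] insert.hyps
      by (simp add: algebra_simps)
    consider "n = 0" | "n = 1" | k where "n = Suc (Suc k)"
      by (metis One_nat_def not0_implies_Suc)
    then show "fps_nth ((1 - fps_const z * fps_X) * F (insert z A)) n =
        fps_nth ((1 - fps_const (q * z) * fps_X) * F A) n"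
    proof cases
      case 1
      then show ?thesis by (simp add: F_def)
    next
      case 2
      \<comment> \<open>The recurrence at \<open>r = 0\<close> involves these values where the
        series has the coefficient 1. The surplus \<open>z * q * q ^ card A\<close> is the same on
        both sides and cancels.\<close>
      have "(1 - q) * hl_row_sum q (insert z A) 0 = 1 - q * q ^ card A"
        "(1 - q) * hl_row_sum q A 0 = 1 - q ^ card A"
        using T[of "insert z A"] T[of A] insert by auto
      with rec[of 0] have "(1 - q) * hl_row_sum q (insert z A) (Suc 0) - z * (1 - q * q ^ card A) =
          (1 - q) * hl_row_sum q A (Suc 0) - q * z * (1 - q ^ card A)" by simp
      then have "(1 - q) * hl_row_sum q (insert z A) (Suc 0) - z =
          (1 - q) * hl_row_sum q A (Suc 0) - q * z" by (simp add: algebra_simps)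
      then show ?thesis unfolding 2 One_nat_def one_minus_const_X_mult_nth by (simp add: F_def)
    next
      case 3
      then show ?thesis using rec[of "Suc k"] by (simp add: one_minus_const_X_mult_nth F_def)
    qed
  qed
  have "F (insert z A) * (\<Prod>x\<in>insert z A. 1 - fps_const x * fps_X) =
      ((1 - fps_const z * fps_X) * F (insert z A)) * (\<Prod>x\<in>A. 1 - fps_const x * fps_X)"
    using insert by (simp add: mult_ac)
  also have "\<dots> = (1 - fps_const (q * z) * fps_X) * (F A * (\<Prod>x\<in>A. 1 - fps_const x * fps_X))"
    by (simp only: step mult.assoc)
  also have "\<dots> = (\<Prod>x\<in>insert z A. 1 - fps_const (q * x) * fps_X)"
    using insert by (simp add: F_def)
  finally show ?case by (simp add: F_def)
qed

section \<open>Monomial expansion of the same product\<close>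

definition monomials :: "nat set \<Rightarrow> nat \<Rightarrow> monomial set" where
  "monomials I r = {m. Poly_Mapping.keys m \<subseteq> I \<and> mdeg m = r}"

definition mono_eval :: "(nat \<Rightarrow> 'a) \<Rightarrow> monomial \<Rightarrow> 'a :: comm_ring_1" where
  "mono_eval x m = (\<Prod>i\<in>Poly_Mapping.keys m. x i ^ Poly_Mapping.lookup m i)"

lemma keys_add_single:
  "Poly_Mapping.keys (m + Poly_Mapping.single i s) =
    (if s = 0 then Poly_Mapping.keys m else insert i (Poly_Mapping.keys m))" for m :: monomial
  by (auto simp: in_keys_iff lookup_add lookup_single when_def split: if_splits)

lemma mdeg_single [simp]: "mdeg (Poly_Mapping.single i s) = s"
  by (simp add: mdeg_def)

lemma mono_eval_add_single:
  assumes "i \<notin> Poly_Mapping.keys m"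
  shows "mono_eval x (m + Poly_Mapping.single i s) = mono_eval x m * x i ^ s"
proof (cases "s = 0")
  case False
  have "(\<Prod>j\<in>Poly_Mapping.keys m. x j ^ Poly_Mapping.lookup (m + Poly_Mapping.single i s) j) =
      (\<Prod>j\<in>Poly_Mapping.keys m. x j ^ Poly_Mapping.lookup m j)"
    using assms by (intro prod.cong) (auto simp: lookup_add lookup_single when_def)
  then show ?thesis using False assms
    by (simp add: mono_eval_def keys_add_single lookup_add in_keys_iff mult.commute)
qed simp

text \<open>Splits off the exponent \<open>s\<close> of the new variable; the inverse map reads this
  exponent and resets it to 0.\<close>

lemma bij_betw_monomials_insert:
  assumes "i \<notin> I"
  shows "bij_betw (\<lambda>(s, m). m + Poly_Mapping.single i s)
    (SIGMA s:{..r}. monomials I (r - s)) (monomials (insert i I) r)"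
proof (rule bij_betw_byWitness[where f' = "\<lambda>m. (Poly_Mapping.lookup m i, Poly_Mapping.update i 0 m)"])
  have upd: "Poly_Mapping.update i 0 m + Poly_Mapping.single i (Poly_Mapping.lookup m i) = m"
    for m :: monomial
    by (rule poly_mapping_eqI) (simp add: lookup_add lookup_update lookup_single when_def)
  show "\<forall>p\<in>SIGMA s:{..r}. monomials I (r - s).
      (\<lambda>m. (Poly_Mapping.lookup m i, Poly_Mapping.update i 0 m))
        ((\<lambda>(s, m). m + Poly_Mapping.single i s) p) = p"
    using assms
    by (auto simp: monomials_def in_keys_iff lookup_add lookup_update lookup_single when_def
        intro!: poly_mapping_eqI)
  show "\<forall>m\<in>monomials (insert i I) r. (\<lambda>(s, m). m + Poly_Mapping.single i s)
      (Poly_Mapping.lookup m i, Poly_Mapping.update i 0 m) = m"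
    by (simp add: upd)
  show "(\<lambda>(s, m). m + Poly_Mapping.single i s) ` (SIGMA s:{..r}. monomials I (r - s)) \<subseteq>
      monomials (insert i I) r"
    by (auto simp: monomials_def keys_add_single mdeg_add split: if_splits)
  show "(\<lambda>m. (Poly_Mapping.lookup m i, Poly_Mapping.update i 0 m)) ` monomials (insert i I) r \<subseteq>
      (SIGMA s:{..r}. monomials I (r - s))"
  proof (rule image_subsetI)
    fix m assume m: "m \<in> monomials (insert i I) r"
    have "mdeg (Poly_Mapping.update i 0 m) + Poly_Mapping.lookup m i = mdeg m"
      using mdeg_add[of "Poly_Mapping.update i 0 m" "Poly_Mapping.single i (Poly_Mapping.lookup m i)"]
      by (simp add: upd)
    then show "(Poly_Mapping.lookup m i, Poly_Mapping.update i 0 m) \<in>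
        (SIGMA s:{..r}. monomials I (r - s))"
      using m by (auto simp: monomials_def keys_update split: if_splits)
  qed
qed

lemma finite_monomials: "finite I \<Longrightarrow> finite (monomials I r)"
proof (induction I arbitrary: r rule: finite_induct)
  case empty
  show ?case by (simp add: monomials_def)
next
  case (insert i I)
  then show ?case
    using bij_betw_finite[OF bij_betw_monomials_insert[of i I r]] by auto
qed

text \<open>The product of the (1 - q x_i t) / (1 - x_i t) over \<open>I\<close>, expanded so that
  no division occurs: a variable contributes \<open>1 - q\<close> once if it occurs, whatever its
  exponent.\<close>

definition hl_row_gen :: "'a \<Rightarrow> (nat \<Rightarrow> 'a) \<Rightarrow> nat set \<Rightarrow> 'a :: comm_ring_1 fps" where
  "hl_row_gen q x I =
     Abs_fps (\<lambda>r. \<Sum>m\<in>monomials I r. (1 - q) ^ card (Poly_Mapping.keys m) * mono_eval x m)"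

lemma hl_row_gen_empty: "hl_row_gen q x {} = 1"
proof -
  have "monomials {} r = (if r = 0 then {0} else {})" for r
    by (auto simp: monomials_def)
  then show ?thesis by (simp add: fps_eq_iff hl_row_gen_def mono_eval_def)
qed

text \<open>Grouping the monomials by the exponent of the new variable turns each coefficient into a
  Cauchy product.\<close>

lemma hl_row_gen_insert:
  assumes I: "finite I" "i \<notin> I"
  shows "hl_row_gen q x (insert i I) =
    Abs_fps (\<lambda>s. if s = 0 then 1 else (1 - q) * x i ^ s) * hl_row_gen q x I"
proof (rule fps_ext)
  fix r
  let ?g = "\<lambda>m. (1 - q) ^ card (Poly_Mapping.keys m) * mono_eval x m"
  have g_add: "?g (m + Poly_Mapping.single i s) = (if s = 0 then 1 else (1 - q) * x i ^ s) * ?g m"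
    if "m \<in> monomials I d" for m s d
  proof -
    have "i \<notin> Poly_Mapping.keys m" using that I by (auto simp: monomials_def)
    then show ?thesis by (simp add: mono_eval_add_single keys_add_single)
  qed
  have "fps_nth (hl_row_gen q x (insert i I)) r =
      (\<Sum>(s, m)\<in>(SIGMA s:{..r}. monomials I (r - s)). ?g (m + Poly_Mapping.single i s))"
    by (simp add: hl_row_gen_def case_prod_beta
        flip: sum.reindex_bij_betw[OF bij_betw_monomials_insert[OF I(2)]])
  also have "\<dots> = (\<Sum>s\<le>r. \<Sum>m\<in>monomials I (r - s). ?g (m + Poly_Mapping.single i s))"
    using I by (intro sum.Sigma[symmetric]) (auto intro: finite_monomials)
  also have "\<dots> = (\<Sum>s\<le>r. (if s = 0 then 1 else (1 - q) * x i ^ s) * (\<Sum>m\<in>monomials I (r - s). ?g m))"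
    using g_add by (simp add: sum_distrib_left cong: sum.cong)
  finally show "fps_nth (hl_row_gen q x (insert i I)) r =
      fps_nth (Abs_fps (\<lambda>s. if s = 0 then 1 else (1 - q) * x i ^ s) * hl_row_gen q x I) r"
    by (simp add: fps_mult_nth hl_row_gen_def atLeast0AtMost)
qed

lemma hl_row_gen_product:
  assumes "finite I"
  shows "hl_row_gen q x I * (\<Prod>i\<in>I. 1 - fps_const (x i) * fps_X) =
    (\<Prod>i\<in>I. 1 - fps_const (q * x i) * fps_X)"
  using assms
proof (induction I rule: finite_induct)
  case empty
  show ?case by (simp add: hl_row_gen_empty)
next
  case (insert i I)
  let ?c = "Abs_fps (\<lambda>s. if s = 0 then 1 else (1 - q) * x i ^ s)"
  \<comment> \<open>In degree 1 the product has \<open>(1 - q) * x i - x i\<close>; from degree 2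
    on, consecutive terms of the geometric tail cancel.\<close>
  have c: "(1 - fps_const (x i) * fps_X) * ?c = 1 - fps_const (q * x i) * fps_X"
  proof (rule fps_ext)
    fix n
    consider "n = 0" | "n = 1" | k where "n = Suc (Suc k)"
      by (metis One_nat_def not0_implies_Suc)
    then show "fps_nth ((1 - fps_const (x i) * fps_X) * ?c) n =
        fps_nth (1 - fps_const (q * x i) * fps_X) n"
      by cases (simp_all add: one_minus_const_X_mult_nth algebra_simps del: fps_mult_nth_1')
  qed
  have "hl_row_gen q x (insert i I) * (\<Prod>j\<in>insert i I. 1 - fps_const (x j) * fps_X) =
      ((1 - fps_const (x i) * fps_X) * ?c) * (hl_row_gen q x I * (\<Prod>j\<in>I. 1 - fps_const (x j) * fps_X))"
    using insert.hyps by (simp add: hl_row_gen_insert mult_ac)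
  then show ?case using insert.hyps by (simp add: c insert.IH)
qed

text \<open>Two series agree after multiplication by the nonzero product of the 1 - x_i t, which
  cancels because power series over a field form a domain. Injectivity of \<open>x\<close> turns the
  set of values back into indices. The factor \<open>1 - q\<close> is kept, as \<open>q = 1\<close>
  is allowed.\<close>

lemma hl_row_sum_eq:
  fixes x :: "nat \<Rightarrow> 'a :: field"
  assumes I: "finite I" "inj_on x I" "0 \<notin> x ` I" and r: "r > 0"
  shows "(1 - q) * (\<Sum>i\<in>I. x i ^ r * (\<Prod>j\<in>I - {i}. (x i - q * x j) / (x i - x j))) =
    (\<Sum>m\<in>monomials I r. (1 - q) ^ card (Poly_Mapping.keys m) * mono_eval x m)"
proof -
  let ?F = "Abs_fps (\<lambda>r. if r = 0 then 1 else (1 - q) * hl_row_sum q (x ` I) r)"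
  let ?D = "\<Prod>i\<in>I. 1 - fps_const (x i) * fps_X"
  have "?F * ?D = hl_row_gen q x I * ?D"
    using hl_row_sum_fps[of "x ` I" q] I
    by (simp add: hl_row_gen_product prod.reindex o_def)
  moreover have "?D \<noteq> 0"
  proof -
    have "1 - fps_const (x i) * fps_X \<noteq> 0" for i
    proof -
      have "fps_nth (1 - fps_const (x i) * fps_X) 0 \<noteq> fps_nth 0 0" by simp
      then show ?thesis by metis
    qed
    then show ?thesis using I(1) by simp
  qed
  ultimately have "?F = hl_row_gen q x I" by simp
  then have "fps_nth ?F r = fps_nth (hl_row_gen q x I) r" by simp
  moreover have "hl_row_sum q (x ` I) r =
      (\<Sum>i\<in>I. x i ^ r * (\<Prod>j\<in>I - {i}. (x i - q * x j) / (x i - x j)))"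
  proof -
    have "(\<Prod>y\<in>x ` I - {x i}. (x i - q * y) / (x i - y)) =
        (\<Prod>j\<in>I - {i}. (x i - q * x j) / (x i - x j))" if "i \<in> I" for i
    proof -
      have "x ` I - {x i} = x ` (I - {i})" "inj_on x (I - {i})"
        using I(2) that by (auto simp: inj_on_def)
      then show ?thesis by (simp add: prod.reindex)
    qed
    then show ?thesis by (simp add: hl_row_sum_def sum.reindex[OF I(2)])
  qed
  ultimately show ?thesis using r by (simp add: hl_row_gen_def)
qed

section \<open>Hall-Littlewood functions of one-row partitions\<close>

lemma part_one_row: "part [r] i = (if i = 0 then r else 0)"
  by (cases i) (simp_all add: part_def nth_default_def)

text \<open>Only index 0 carries a positive part, so the stabilizer consists of the permutations
  fixing 0 and a coset is determined by the value \<open>w 0\<close>. Transpositions realize every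
  value below \<open>k\<close>.\<close>

lemma hl_cosets_one_row:
  assumes "r > 0" "k > 0"
  shows "hl_cosets [r] k = (\<lambda>i. {w. w permutes {..<k} \<and> w 0 = i}) ` {..<k}"
proof -
  define D where "D i = {w. w permutes {..<k} \<and> w 0 = i}" for i
  have stab: "hl_stab [r] k = {s. s permutes {..<k} \<and> s 0 = 0}"
  proof -
    have "(\<forall>i<k. part [r] (s i) = part [r] i) \<longleftrightarrow> s 0 = 0" if s: "s permutes {..<k}" for s
    proof
      assume "\<forall>i<k. part [r] (s i) = part [r] i"
      then have "part [r] (s 0) = part [r] 0" using assms by blast
      then show "s 0 = 0" using assms by (simp add: part_one_row split: if_splits)
    next
      assume s0: "s 0 = 0"
      have "s i = 0 \<longleftrightarrow> i = 0" for i
        using s0 inj_eq[OF permutes_inj[OF s], of i 0] by simp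
      then show "\<forall>i<k. part [r] (s i) = part [r] i" by (simp add: part_one_row)
    qed
    then show ?thesis unfolding hl_stab_def by blast
  qed
  have coset: "(\<lambda>s. w \<circ> s) ` hl_stab [r] k = {u. u permutes {..<k} \<and> u 0 = w 0}"
    if w: "w permutes {..<k}" for w
  proof
    show "(\<lambda>s. w \<circ> s) ` hl_stab [r] k \<subseteq> {u. u permutes {..<k} \<and> u 0 = w 0}"
      using permutes_compose[OF _ w] by (auto simp: stab)
    show "{u. u permutes {..<k} \<and> u 0 = w 0} \<subseteq> (\<lambda>s. w \<circ> s) ` hl_stab [r] k"
    proof
      fix u assume u: "u \<in> {u. u permutes {..<k} \<and> u 0 = w 0}"
      then have "inv w \<circ> u \<in> hl_stab [r] k"
        using permutes_compose[OF _ permutes_inv[OF w], of u] permutes_inverses(2)[OF w]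
        by (simp add: stab)
      moreover have "u = w \<circ> (inv w \<circ> u)"
        using permutes_inverses(1)[OF w] by (simp add: fun_eq_iff)
      ultimately show "u \<in> (\<lambda>s. w \<circ> s) ` hl_stab [r] k" by blast
    qed
  qed
  have "(\<lambda>w. w 0) ` {w. w permutes {..<k}} = {..<k}"
  proof
    show "(\<lambda>w. w 0) ` {w. w permutes {..<k}} \<subseteq> {..<k}"
      using assms permutes_in_image[of _ "{..<k}" 0] by auto
    show "{..<k} \<subseteq> (\<lambda>w. w 0) ` {w. w permutes {..<k}}"
    proof
      fix i assume "i \<in> {..<k}"
      then have "transpose 0 i permutes {..<k}" using assms by (simp add: permutes_swap_id)
      then show "i \<in> (\<lambda>w. w 0) ` {w. w permutes {..<k}}"
        by (intro image_eqI[of _ _ "transpose 0 i"]) auto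
    qed
  qed
  then have "D ` {..<k} = (\<lambda>w. D (w 0)) ` {w. w permutes {..<k}}"
    using image_image[of D "\<lambda>w. w 0" "{w. w permutes {..<k}}"] by (simp only:)
  also have "\<dots> = hl_cosets [r] k"
    unfolding hl_cosets_def by (rule image_cong) (simp_all add: coset D_def)
  finally show ?thesis unfolding D_def ..
qed

text \<open>The pairs with \<open>part [r] i > part [r] j\<close> are those with
  \<open>i = 0\<close> and \<open>j > 0\<close>; the images \<open>w j\<close> run over every index
  but \<open>w 0\<close>.\<close>

lemma hl_term_one_row:
  assumes k: "k > 0" and r: "r > 0" and w: "w permutes {..<k}"
  shows "hl_term [r] k w = Y (w 0) ^ r *
    (\<Prod>j\<in>{..<k} - {w 0}. (Y (w 0) - Yq * Y j) / (Y (w 0) - Y j))"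
proof -
  have "(\<Prod>i<k. Y (w i) ^ part [r] i) = (\<Prod>i\<in>{0}. Y (w i) ^ part [r] i)"
    using k by (intro prod.mono_neutral_right) (auto simp: part_one_row)
  then have 1: "(\<Prod>i<k. Y (w i) ^ part [r] i) = Y (w 0) ^ r" by (simp add: part_one_row)
  have pairs: "{(i, j). i < k \<and> j < k \<and> part [r] i > part [r] j} = Pair 0 ` ({..<k} - {0})"
    using k r by (auto simp: part_one_row)
  have w_img: "w ` ({..<k} - {0}) = {..<k} - {w 0}"
    using permutes_image[OF w] permutes_inj[OF w] by (simp add: image_set_diff)
  have "(\<Prod>(i, j)\<in>{(i, j). i < k \<and> j < k \<and> part [r] i > part [r] j}.
        (Y (w i) - Yq * Y (w j)) / (Y (w i) - Y (w j))) =
      (\<Prod>j\<in>{..<k} - {0}. (Y (w 0) - Yq * Y (w j)) / (Y (w 0) - Y (w j)))"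
    unfolding pairs by (subst prod.reindex) (auto simp: inj_on_def)
  also have "\<dots> = (\<Prod>j\<in>{..<k} - {w 0}. (Y (w 0) - Yq * Y j) / (Y (w 0) - Y j))"
    unfolding w_img[symmetric]
    by (subst prod.reindex) (auto intro: inj_on_subset[OF permutes_inj[OF w]])
  finally show ?thesis unfolding hl_term_def 1 by simp
qed

lemma hl_fract_one_row:
  assumes "r > 0" "k > 0"
  shows "hl_fract [r] k =
    (\<Sum>i<k. Y i ^ r * (\<Prod>j\<in>{..<k} - {i}. (Y i - Yq * Y j) / (Y i - Y j)))"
proof -
  define D where "D i = {w. w permutes {..<k} \<and> w 0 = i}" for i
  have D_some: "(SOME w. w \<in> D i) \<in> D i" if "i < k" for i
  proof -
    have "transpose 0 i \<in> D i" using assms that by (simp add: D_def permutes_swap_id)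
    then show ?thesis by (metis someI)
  qed
  \<comment> \<open>The sets \<open>D i\<close> are nonempty with distinct values at 0, so the sum
    over the set of cosets merges no two indices.\<close>
  have inj: "inj_on D {..<k}"
  proof (rule inj_onI)
    fix i j assume ij: "i \<in> {..<k}" "j \<in> {..<k}" "D i = D j"
    then have "(SOME w. w \<in> D i) \<in> D i \<inter> D j" using D_some[of i] by simp
    then show "i = j" by (auto simp: D_def)
  qed
  have "hl_fract [r] k = (\<Sum>i<k. hl_term [r] k (SOME w. w \<in> D i))"
    unfolding hl_fract_def hl_cosets_one_row[OF assms] D_def[symmetric]
    by (simp add: sum.reindex[OF inj])
  also have "\<dots> = (\<Sum>i<k. Y i ^ r * (\<Prod>j\<in>{..<k} - {i}. (Y i - Yq * Y j) / (Y i - Y j)))"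
  proof (rule sum.cong)
    fix i assume "i \<in> {..<k}"
    then have "(SOME w. w \<in> D i) \<in> D i" using D_some by simp
    then have "(SOME w. w \<in> D i) permutes {..<k}" "(SOME w. w \<in> D i) 0 = i"
      by (simp_all add: D_def)
    then show "hl_term [r] k (SOME w. w \<in> D i) =
        Y i ^ r * (\<Prod>j\<in>{..<k} - {i}. (Y i - Yq * Y j) / (Y i - Y j))"
      using assms by (simp add: hl_term_one_row)
  qed simp
  finally show ?thesis .
qed

text \<open>This and the next two facts let \<open>hl_row_sum_eq\<close> be applied at the variables
  and let \<open>1 - Yq\<close> be cancelled.\<close>

lemma inj_Y: "inj Y"
proof (rule injI)
  fix i j assume "Y i = Y j"
  then have "Poly_Mapping.single (Poly_Mapping.single i (1 :: nat)) (1 :: rat poly) =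
      Poly_Mapping.single (Poly_Mapping.single j 1) 1"
    unfolding Y_def to_fract_eq_iff .
  then have "Poly_Mapping.keys (Poly_Mapping.single (Poly_Mapping.single i (1 :: nat)) (1 :: rat poly)) =
      Poly_Mapping.keys (Poly_Mapping.single (Poly_Mapping.single j (1 :: nat)) (1 :: rat poly))"
    by simp
  then have "Poly_Mapping.single i (1 :: nat) = Poly_Mapping.single j 1" by simp
  then have "Poly_Mapping.keys (Poly_Mapping.single i (1 :: nat)) =
      Poly_Mapping.keys (Poly_Mapping.single j (1 :: nat))" by simp
  then show "i = j" by simp
qed

lemma Y_neq_0: "Y i \<noteq> 0"
proof -
  have "Poly_Mapping.keys (Poly_Mapping.single (Poly_Mapping.single i (1 :: nat)) (1 :: rat poly)) \<noteq> {}"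
    by simp
  then show ?thesis unfolding Y_def by (metis keys_zero to_fract_eq_0_iff)
qed

lemma Yq_neq_1: "Yq \<noteq> 1"
proof
  assume "Yq = 1"
  then have "to_fract (Poly_Mapping.single 0 [:0, 1:] :: ypoly) = to_fract (Poly_Mapping.single 0 1)"
    by (simp add: Yq_def)
  then have "(Poly_Mapping.single 0 [:0, 1:] :: ypoly) = Poly_Mapping.single 0 1"
    by (simp only: to_fract_eq_iff)
  then have "Poly_Mapping.lookup (Poly_Mapping.single (0 :: monomial) [:0, 1 :: rat:]) 0 =
      Poly_Mapping.lookup (Poly_Mapping.single (0 :: monomial) 1) 0" by simp
  then show False by (simp add: one_pCons)
qed

lemma mono_eval_Y: "mono_eval Y m = to_fract (Poly_Mapping.single m 1)"
proof -
  have mult: "to_fract (Poly_Mapping.single a 1 :: ypoly) * to_fract (Poly_Mapping.single b 1) =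
      to_fract (Poly_Mapping.single (a + b) 1)" for a b
    by (simp only: to_fract_mult[symmetric] mult_single mult_1)
  have pow: "Y i ^ n = to_fract (Poly_Mapping.single (Poly_Mapping.single i n) 1)" for i n
  proof (induction n)
    case 0
    show ?case by (simp only: power_0 single_zero single_one to_fract_1)
  next
    case (Suc n)
    have "Y i ^ Suc n = to_fract (Poly_Mapping.single (Poly_Mapping.single i 1) 1) *
        to_fract (Poly_Mapping.single (Poly_Mapping.single i n) 1)"
      by (simp only: power_Suc Suc.IH) (simp only: Y_def)
    also have "\<dots> = to_fract (Poly_Mapping.single (Poly_Mapping.single i (Suc n)) 1)"
      by (simp only: mult single_add[symmetric] plus_1_eq_Suc)
    finally show ?case .
  qed
  have "(\<Prod>i\<in>I. Y i ^ Poly_Mapping.lookup m i) =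
      to_fract (Poly_Mapping.single (\<Sum>i\<in>I. Poly_Mapping.single i (Poly_Mapping.lookup m i)) 1)"
    if "finite I" for I
    using that
    by (induction I rule: finite_induct)
      (simp_all only: pow mult prod.insert sum.insert prod.empty sum.empty single_one to_fract_1
        not_False_eq_True)
  moreover have "(\<Sum>i\<in>Poly_Mapping.keys m. Poly_Mapping.single i (Poly_Mapping.lookup m i)) = m"
    by (rule poly_mapping_eqI)
       (auto simp: lookup_sum lookup_single when_def in_keys_iff sum.delta)
  ultimately show ?thesis unfolding mono_eval_def by simp
qed

lemma one_minus_Yq_power:
  "(1 - Yq) ^ n = to_fract (Poly_Mapping.single 0 ([:1, - 1:] ^ n))"
proof (induction n)
  case (Suc n)
  have one: "1 - Yq = to_fract (Poly_Mapping.single 0 [:1, - 1:])"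
  proof -
    have "1 - Yq = to_fract (Poly_Mapping.single 0 1 - Poly_Mapping.single 0 [:0, 1:])"
      by (simp add: Yq_def)
    also have "\<dots> = to_fract (Poly_Mapping.single 0 [:1, - 1:])"
      by (simp only: single_diff[symmetric]) (simp add: one_pCons)
    finally show ?thesis .
  qed
  have "(1 - Yq) ^ Suc n = (1 - Yq) * to_fract (Poly_Mapping.single 0 ([:1, - 1:] ^ n))"
    by (simp only: power_Suc Suc.IH)
  also have "\<dots> = to_fract (Poly_Mapping.single 0 ([:1, - 1:] ^ Suc n))"
    by (simp only: one to_fract_mult[symmetric] mult_single add_0 power_Suc)
  finally show ?case .
qed (simp only: power_0 single_one to_fract_1)

text \<open>Take \<open>hl_row_sum_eq\<close> at the points \<open>Y i\<close> with
  \<open>q = Yq\<close>. A monomial of degree \<open>r > 0\<close> involves some variable, so each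
  term has a factor \<open>1 - Yq\<close> to cancel. Injectivity of \<open>to_fract\<close> then
  identifies the polynomial chosen by \<open>hl_poly\<close>.\<close>

lemma hl_poly_one_row:
  assumes "r > 0" "k > 0"
  shows "hl_poly [r] k =
    (\<Sum>m\<in>monomials {..<k} r. Poly_Mapping.single m ([:1, - 1:] ^ (card (Poly_Mapping.keys m) - 1)))"
    (is "_ = ?p")
proof -
  have "(1 - Yq) * hl_fract [r] k =
      (\<Sum>m\<in>monomials {..<k} r. (1 - Yq) ^ card (Poly_Mapping.keys m) * mono_eval Y m)"
    unfolding hl_fract_one_row[OF assms] using assms inj_Y Y_neq_0
    by (intro hl_row_sum_eq) (auto intro: inj_on_subset)
  also have "\<dots> = (1 - Yq) * to_fract ?p"
  proof -
    have "(1 - Yq) ^ card (Poly_Mapping.keys m) * mono_eval Y m = (1 - Yq) *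
        to_fract (Poly_Mapping.single m ([:1, - 1:] ^ (card (Poly_Mapping.keys m) - 1)))"
      if m: "m \<in> monomials {..<k} r" for m
    proof -
      have "m \<noteq> 0" using m assms by (auto simp: monomials_def)
      then have "card (Poly_Mapping.keys m) \<noteq> 0" by (simp add: keys_eq_empty)
      then obtain n where n: "card (Poly_Mapping.keys m) = Suc n" using not0_implies_Suc by blast
      have "(1 - Yq) ^ n * mono_eval Y m = to_fract (Poly_Mapping.single m ([:1, - 1:] ^ n))"
        by (simp only: one_minus_Yq_power mono_eval_Y to_fract_mult[symmetric] mult_single
            add_0 mult_1_right)
      then show ?thesis by (simp add: n mult.assoc)
    qed
    then show ?thesis by (simp add: sum_distrib_left)
  qed
  finally have p: "to_fract ?p = hl_fract [r] k"
    using Yq_neq_1 by (simp only: mult_cancel_left right_minus_eq) simp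
  show ?thesis
    unfolding hl_poly_def
  proof (rule the_equality)
    show "to_fract ?p = hl_fract [r] k" by (rule p)
  next
    fix p assume "to_fract p = hl_fract [r] k"
    then have "to_fract p = to_fract ?p" by (simp only: p)
    then show "p = ?p" by (simp only: to_fract_eq_iff)
  qed
qed

text \<open>Once \<open>k\<close> exceeds every variable index in \<open>m\<close>, the coefficient
  at \<open>m\<close> no longer changes. Its value depends only on the degree and the number of
  variables of \<open>m\<close>, so the limits form a symmetric function.\<close>

lemma sf_coeff_hall_littlewood_one_row:
  assumes r: "r > 0"
  shows "sf_coeff (hall_littlewood [r]) m =
    (if mdeg m = r then [:1, - 1:] ^ (card (Poly_Mapping.keys m) - 1) else 0)"
proof -
  define c :: "monomial \<Rightarrow> rat poly" where
    "c m = (if mdeg m = r then [:1, - 1:] ^ (card (Poly_Mapping.keys m) - 1) else 0)" for m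
  have "c (Poly_Mapping.map_key \<sigma> m) = c m" if "bij \<sigma>" for \<sigma> m
  proof -
    have "card (\<sigma> -` Poly_Mapping.keys m) = card (Poly_Mapping.keys m)"
      using that by (intro card_vimage_inj) (auto simp: bij_def)
    then show ?thesis
      using that by (simp add: c_def mdeg_map_key keys_map_key bij_is_inj)
  qed
  moreover have "\<forall>m. mdeg m > r \<longrightarrow> c m = 0" by (simp add: c_def)
  ultimately have f: "sf_coeff (Abs_symfun c) = c" by (subst Abs_symfun_inverse) auto
  have lim: "\<forall>\<^sub>F k in sequentially. Poly_Mapping.lookup (hl_poly [r] k) m = c m" for m
  proof -
    \<comment> \<open>The inserted 0 keeps the argument of \<open>Max\<close> nonempty when
      \<open>m = 0\<close>.\<close>
    have "\<forall>\<^sub>F k in sequentially. k > Max (insert 0 (Poly_Mapping.keys m))"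
      by (rule eventually_gt_at_top)
    then show ?thesis
    proof eventually_elim
      case (elim k)
      have "Poly_Mapping.keys m \<subseteq> {..<k}" and k: "k > 0" using elim by auto
      then have "m \<in> monomials {..<k} r \<longleftrightarrow> mdeg m = r" by (simp add: monomials_def)
      then show ?case
        by (simp add: hl_poly_one_row[OF r k] lookup_sum lookup_single when_def sum.delta
            finite_monomials c_def)
    qed
  qed
  have "hall_littlewood [r] = Abs_symfun c"
    unfolding hall_littlewood_def
  proof (rule the_equality)
    show "\<forall>m. \<forall>\<^sub>F k in sequentially. Poly_Mapping.lookup (hl_poly [r] k) m = sf_coeff (Abs_symfun c) m"
      using lim by (simp add: f)
    fix g assume g: "\<forall>m. \<forall>\<^sub>F k in sequentially. Poly_Mapping.lookup (hl_poly [r] k) m = sf_coeff g m"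
    show "g = Abs_symfun c"
    proof (rule symfun_eqI)
      fix m
      have "\<forall>\<^sub>F k in sequentially. sf_coeff g m = c m"
        using g[rule_format, of m] lim[of m] by eventually_elim simp
      \<comment> \<open>Neither side depends on \<open>k\<close>, so eventual equality is
        equality.\<close>
      then show "sf_coeff g m = sf_coeff (Abs_symfun c) m" by (simp add: f)
    qed
  qed
  then show ?thesis by (simp add: f c_def)
qed

section \<open>Substitution for q in the one-row functions\<close>

text \<open>Multiplication by \<open>[:1, - 1:]\<close> is the operation
  \<open>p - pCons 0 p\<close>, which is compatible with the coefficient embedding and with
  evaluation, so induction on \<open>n\<close> works.\<close>

lemma poly_map_poly_one_minus_power:
  "poly (map_poly (\<lambda>c. to_fract [:c:]) ([:1, - 1:] ^ n :: rat poly)) x = (1 - x) ^ n"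
proof (induction n)
  case 0
  show ?case by (simp add: map_poly_1 flip: one_pCons)
next
  case (Suc n)
  let ?h = "\<lambda>c :: rat. to_fract [:c:]"
  let ?p = "[:1, - 1:] ^ n :: rat poly"
  have "map_poly ?h (?p - pCons 0 ?p) = map_poly ?h ?p - pCons 0 (map_poly ?h ?p)"
    by (rule poly_eqI)
       (simp add: coeff_map_poly coeff_pCons split: nat.split flip: to_fract_diff)
  moreover have "[:1, - 1:] ^ Suc n = ?p - pCons 0 ?p" by simp
  ultimately have "map_poly ?h ([:1, - 1:] ^ Suc n) = map_poly ?h ?p - pCons 0 (map_poly ?h ?p)"
    by (simp only:)
  then show ?case
    by (simp only: poly_diff poly_pCons Suc.IH power_Suc left_diff_distrib mult_1 add_0)
qed

lemma sf_coeff_subst_hall_littlewood_one_row: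
  assumes "r > 0"
  shows "sf_coeff (sf_subst x (hall_littlewood [r])) m =
    (if mdeg m = r then (1 - x) ^ (card (Poly_Mapping.keys m) - 1) else 0)"
  using assms
  by (simp add: sf_subst.rep_eq sf_coeff_hall_littlewood_one_row poly_map_poly_one_minus_power)

section \<open>Comparison of coefficients in H(qt), and the identity\<close>

lemma sf_coeff_sum: "sf_coeff (sum f A) m = (\<Sum>a\<in>A. sf_coeff (f a) m)"
  by (induction A rule: infinite_finite_induct) (simp_all add: zero_symfun.rep_eq plus_symfun.rep_eq)

lemma sf_coeff_const_mult: "sf_coeff (sf_const c * f) m = c * sf_coeff f m"
proof -
  have "sf_coeff (sf_const c * f) m =
      (\<Sum>(a, b)\<in>msplit m. (if a = 0 then c else 0) * sf_coeff f b)"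
    by (simp add: times_symfun.rep_eq sf_const.rep_eq)
  also have "\<dots> = (\<Sum>(a, b)\<in>{(0 :: monomial, m)}. (if a = 0 then c else 0) * sf_coeff f b)"
    by (rule sum.mono_neutral_right[OF finite_msplit]) (auto simp: msplit_def split: if_splits)
  finally show ?thesis by simp
qed

text \<open>A splitting of \<open>m\<close> is an independent choice, for each variable of
  \<open>m\<close>, of an exponent of \<open>b\<close> up to that in \<open>m\<close>, so the sum
  factors. Since \<open>f 0 = 1\<close>, the product over the variables of \<open>b\<close> extends
  to all those of \<open>m\<close>.\<close>

lemma sum_msplit_prod:
  fixes f :: "nat \<Rightarrow> 'a :: comm_ring_1"
  assumes "f 0 = 1"
  shows "(\<Sum>(a, b)\<in>msplit m. \<Prod>i\<in>Poly_Mapping.keys b. f (Poly_Mapping.lookup b i)) =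
    (\<Prod>i\<in>Poly_Mapping.keys m. \<Sum>j\<le>Poly_Mapping.lookup m i. f j)"
proof -
  let ?K = "Poly_Mapping.keys m"
  let ?P = "PiE ?K (\<lambda>i. {..Poly_Mapping.lookup m i})"
  \<comment> \<open>The monomial with the exponents chosen by \<open>g\<close>, cut off outside the
    variables of \<open>m\<close> to have finite support.\<close>
  define B where "B g = Abs_poly_mapping (\<lambda>i. if i \<in> ?K then g i else 0)" for g :: "nat \<Rightarrow> nat"
  have B: "Poly_Mapping.lookup (B g) i = (if i \<in> ?K then g i else 0)" for g i
    unfolding B_def by (subst lookup_Abs_poly_mapping) auto
  have split: "b = m - a" "a = m - b" "Poly_Mapping.lookup b i \<le> Poly_Mapping.lookup m i"
    "Poly_Mapping.keys b \<subseteq> ?K" if "(a, b) \<in> msplit m" for a b i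
    using that by (auto simp: msplit_def lookup_add in_keys_iff)
  have "(\<Sum>(a, b)\<in>msplit m. \<Prod>i\<in>Poly_Mapping.keys b. f (Poly_Mapping.lookup b i)) =
      (\<Sum>g\<in>?P. \<Prod>i\<in>?K. f (g i))"
  proof (rule sum.reindex_bij_witness[where i = "\<lambda>g. (m - B g, B g)" and
        j = "\<lambda>(a, b). restrict (Poly_Mapping.lookup b) ?K"])
    fix p assume p: "p \<in> msplit m"
    obtain a b where ab: "p = (a, b)" by (cases p)
    have "B (restrict (Poly_Mapping.lookup b) ?K) = b"
      using split(4)[of a b] p ab by (intro poly_mapping_eqI) (auto simp: B in_keys_iff)
    then show "(\<lambda>g. (m - B g, B g)) ((\<lambda>(a, b). restrict (Poly_Mapping.lookup b) ?K) p) = p"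
      using split(2)[of a b] p ab by simp
    show "(\<lambda>(a, b). restrict (Poly_Mapping.lookup b) ?K) p \<in> ?P"
      using split(3)[of a b] p ab by auto
    have "(\<Prod>i\<in>?K. f (Poly_Mapping.lookup b i)) =
        (\<Prod>i\<in>Poly_Mapping.keys b. f (Poly_Mapping.lookup b i))"
      using split(4)[of a b] p ab assms by (intro prod.mono_neutral_right) (auto simp: in_keys_iff)
    then show "(\<Prod>i\<in>?K. f ((\<lambda>(a, b). restrict (Poly_Mapping.lookup b) ?K) p i)) =
        (case p of (a, b) \<Rightarrow> \<Prod>i\<in>Poly_Mapping.keys b. f (Poly_Mapping.lookup b i))"
      using ab by simp
  next
    fix g assume g: "g \<in> ?P"
    have "m - B g + B g = m"
    proof (rule poly_mapping_eqI)
      fix i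
      show "Poly_Mapping.lookup (m - B g + B g) i = Poly_Mapping.lookup m i"
        using g by (auto simp: lookup_add lookup_minus B in_keys_iff PiE_iff)
    qed
    then show "(m - B g, B g) \<in> msplit m" by (simp add: msplit_def)
    show "(\<lambda>(a, b). restrict (Poly_Mapping.lookup b) ?K) (m - B g, B g) = g"
      using g by (auto simp: B restrict_def PiE_def extensional_def)
  qed
  also have "\<dots> = (\<Prod>i\<in>?K. \<Sum>j\<le>Poly_Mapping.lookup m i. f j)"
    by (rule prod_sum_PiE[symmetric]) auto
  finally show ?thesis .
qed

lemma sum_msplit_telescope:
  fixes q :: "'a :: field"
  assumes q: "q \<noteq> 0"
  shows "(\<Sum>(a, b)\<in>msplit m. q ^ mdeg b * (1 - inverse q) ^ card (Poly_Mapping.keys b)) = q ^ mdeg m"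
proof -
  let ?f = "\<lambda>j. if j = 0 then 1 else q ^ j * (1 - inverse q)"
  \<comment> \<open>For \<open>j > 0\<close> the summand is
    \<open>q ^ j - q ^ (j - 1)\<close>.\<close>
  have tele: "(\<Sum>j\<le>n. ?f j) = q ^ n" for n
    by (induction n) (use q in \<open>simp_all add: field_simps\<close>)
  have "(\<Prod>i\<in>Poly_Mapping.keys b. ?f (Poly_Mapping.lookup b i)) =
      q ^ mdeg b * (1 - inverse q) ^ card (Poly_Mapping.keys b)" for b
  proof -
    have "(\<Prod>i\<in>Poly_Mapping.keys b. ?f (Poly_Mapping.lookup b i)) =
        (\<Prod>i\<in>Poly_Mapping.keys b. q ^ Poly_Mapping.lookup b i * (1 - inverse q))"
      by (intro prod.cong) (auto simp: in_keys_iff)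
    then show ?thesis by (simp add: prod.distrib mdeg_def power_sum)
  qed
  then have "(\<Sum>(a, b)\<in>msplit m. q ^ mdeg b * (1 - inverse q) ^ card (Poly_Mapping.keys b)) =
      (\<Prod>i\<in>Poly_Mapping.keys m. \<Sum>j\<le>Poly_Mapping.lookup m i. ?f j)"
    using sum_msplit_prod[of ?f m] by simp
  then show ?thesis by (simp only: tele mdeg_def power_sum)
qed

lemma sf_const_power: "sf_const (c ^ n) = sf_const c ^ n"
  by (induction n) (simp_all add: sf_const_mult)

text \<open>The second factor is H(qt) / H(t), with coefficient \<open>qvar ^ mdeg b * (1 - inverse
  qvar) ^ card (Poly_Mapping.keys b)\<close> at \<open>b\<close>. All monomials have coefficient 1
  in H, so the convolution is the sum in \<open>sum_msplit_telescope\<close>.\<close>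

lemma sf_H_compose_qt:
  "sf_H oo qt = sf_H * (1 - fps_const (1 - sf_q) * (Abs_fps (\<lambda>r. if r = 0 then 0
      else sf_const (inverse qvar) * sf_subst (inverse qvar) (hall_littlewood [r])) oo qt))"
    (is "_ = sf_H * ?K")
proof (rule fps_ext, rule symfun_eqI)
  fix r m
  have K: "sf_coeff (fps_nth ?K n) b =
      (if mdeg b = n then qvar ^ n * (1 - inverse qvar) ^ card (Poly_Mapping.keys b) else 0)" for n b
  proof (cases "n = 0")
    case True
    then show ?thesis by (simp add: one_symfun.rep_eq)
  next
    case False
    have "fps_nth ?K n = sf_const (- ((1 - qvar) * qvar ^ n * inverse qvar)) *
        sf_subst (inverse qvar) (hall_littlewood [n])"
      using False by (simp add: sf_const_power sf_const_mult sf_const_diff sf_const_uminus mult.assoc)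
    \<comment> \<open>The sign and \<open>inverse qvar\<close> turn \<open>1 - qvar\<close> into
      \<open>1 - inverse qvar\<close>, the one factor by which the one-row coefficient falls short
      of the full power.\<close>
    moreover have "- ((1 - qvar) * qvar ^ n * inverse qvar) = qvar ^ n * (1 - inverse qvar)"
      using qvar_neq by (simp add: field_simps)
    moreover have "card (Poly_Mapping.keys b) = Suc (card (Poly_Mapping.keys b) - 1)" if "mdeg b = n"
    proof -
      have "b \<noteq> 0" using that False by auto
      then show ?thesis by (simp add: keys_eq_empty card_gt_0_iff)
    qed
    ultimately show ?thesis using False
      by (auto simp: sf_coeff_const_mult sf_coeff_subst_hall_littlewood_one_row mult.assoc
          simp flip: power_Suc)
  qed
  have "sf_coeff (fps_nth (sf_H * ?K) r) m =
      (\<Sum>s=0..r. \<Sum>(a, b)\<in>msplit m. (if mdeg a = s then 1 else 0) * sf_coeff (fps_nth ?K (r - s)) b)"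
    by (simp only: fps_mult_nth sf_coeff_sum times_symfun.rep_eq sf_H_def fps_nth_Abs_fps sf_h.rep_eq)
  also have "\<dots> = (\<Sum>p\<in>msplit m. \<Sum>s=0..r.
      (if mdeg (fst p) = s then 1 else 0) * sf_coeff (fps_nth ?K (r - s)) (snd p))"
    by (subst sum.swap) (simp only: case_prod_beta)
  also have "\<dots> = (\<Sum>p\<in>msplit m. if mdeg m = r
      then qvar ^ mdeg (snd p) * (1 - inverse qvar) ^ card (Poly_Mapping.keys (snd p)) else 0)"
  proof (rule sum.cong)
    fix p assume "p \<in> msplit m"
    then have deg: "mdeg m = mdeg (fst p) + mdeg (snd p)"
      using mdeg_add by (auto simp: msplit_def)
    have "(\<Sum>s=0..r. (if mdeg (fst p) = s then 1 else 0) * sf_coeff (fps_nth ?K (r - s)) (snd p)) =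
        (\<Sum>s=0..r. if mdeg (fst p) = s then sf_coeff (fps_nth ?K (r - s)) (snd p) else 0)"
      by (intro sum.cong) simp_all
    also have "\<dots> = (if mdeg (fst p) \<le> r then sf_coeff (fps_nth ?K (r - mdeg (fst p))) (snd p) else 0)"
      by (simp only: sum.delta' finite_atLeastAtMost atLeastAtMost_iff le0 simp_thms)
    \<comment> \<open>If \<open>mdeg (fst p) > r\<close>, then \<open>mdeg m > r\<close> and both
      sides vanish; otherwise the natural-number difference is exact and equals
      \<open>mdeg (snd p)\<close> iff \<open>mdeg m = r\<close>.\<close>
    also have "\<dots> = (if mdeg m = r
        then qvar ^ mdeg (snd p) * (1 - inverse qvar) ^ card (Poly_Mapping.keys (snd p)) else 0)"
      unfolding K using deg by auto
    finally show "(\<Sum>s=0..r. (if mdeg (fst p) = s then 1 else 0) *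
          sf_coeff (fps_nth ?K (r - s)) (snd p)) = (if mdeg m = r
        then qvar ^ mdeg (snd p) * (1 - inverse qvar) ^ card (Poly_Mapping.keys (snd p)) else 0)" .
  qed simp
  also have "\<dots> = (if mdeg m = r then qvar ^ r else 0)"
    using sum_msplit_telescope[OF qvar_neq(1), of m] by (auto simp: case_prod_beta)
  also have "\<dots> = sf_coeff (fps_nth (sf_H oo qt) r) m"
    by (simp add: sf_H_def sf_coeff_const_mult sf_h.rep_eq flip: sf_const_power)
  finally show "sf_coeff (fps_nth (sf_H oo qt) r) m = sf_coeff (fps_nth (sf_H * ?K) r) m" ..
qed

theorem propositionA3:
  shows "(1 - fps_const sf_q) * sf_H / ((sf_H oo qt) - fps_const sf_q * sf_H) =
    inverse (1 - (Abs_fps (\<lambda>r. if r = 0 then 0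
        else sf_const (inverse qvar) * sf_subst (inverse qvar) (hall_littlewood [r])) oo qt))"
proof -
  define P where "P = Abs_fps (\<lambda>r. if r = 0 then 0
    else sf_const (inverse qvar) * sf_subst (inverse qvar) (hall_littlewood [r])) oo qt"
  let ?D = "(sf_H oo qt) - fps_const sf_q * sf_H"
  let ?N = "(1 - fps_const sf_q) * sf_H"
  have c: "fps_const (1 - sf_q) = 1 - fps_const sf_q"
    by (simp only: fps_const_sub[symmetric] fps_const_1_eq_1)
  \<comment> \<open>With H(qt) = H(t) (1 - (1 - q) P), the terms H - q H combine to (1 - q) H, which
    is then a common factor.\<close>
  have D: "?D = ?N * (1 - P)"
    unfolding sf_H_compose_qt P_def[symmetric] c by (simp add: algebra_simps)
  have R: "(1 - P) * inverse (1 - P) = 1"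
    unfolding P_def by (rule fps_symfun_inverse) (rule denominator_rhs_unit)
  have "?N / ?D = ?N * inverse ?D" by (rule fps_symfun_divide(1)[OF denominator_lhs_unit])
  \<comment> \<open>Inserting this 1 completes the numerator to \<open>?D\<close>, which meets its
    own inverse; both inverses are genuine because the constant coefficients are units.\<close>
  also have "\<dots> = ?N * ((1 - P) * inverse (1 - P)) * inverse ?D" by (simp only: R mult_1_right)
  also have "\<dots> = (?N * (1 - P)) * inverse ?D * inverse (1 - P)" by (simp only: mult_ac)
  also have "\<dots> = ?D * inverse ?D * inverse (1 - P)" by (simp only: D[symmetric])
  also have "\<dots> = inverse (1 - P)"
    by (simp only: fps_symfun_inverse[OF denominator_lhs_unit] mult_1_left)
  finally show ?thesis unfolding P_def .
qed

end
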